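(* Let $\{a_{i,j}\}_{1\le i,j\le n}$ be a collection of non-negative numbers, and let $\Pi_n$ be a random uniform permutation of $\{1,\dots,n\}$. Consider $Z_n=\sum_{i=1}^n a_{i,\Pi_n(i)}$. Then, for all $x>0$, $$\mathbb{P}\left(\left|Z_n-\mathbb{E}[Z_n]\right|\ \ge\ 2\sqrt{\left(\frac1n\sum_{i,j=1}^n a_{i,j}^2\right)x}+\max_{1\le i,j\le n}\{a_{i,j}\}\,x\right)\ \le\ 8\,e^{1/16}\exp\left(-\frac{x}{16}\right).$$
   Context: Here $n$ is a positive integer. A random uniform permutation of $\{1,\dots,n\}$ takes each of the $n!$ permutations with probability $1/n!$.
   Formalization: The formal version assumes that at least one of the numbers a_{i,j} is nonzero; if all are zero, the deviation and the threshold are both 0, the event has probability 1, and the bound fails for x > 1 + 16 ln 8. *)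

theory Defs
  imports "HOL-Probability.Probability" "HOL-Combinatorics.Permutations"
begin

(* Permutations of {1..n} are functions on nat that fix every point outside {1..n} (permutes),
   so there are exactly n! of them.  Only the law of \<sigma> matters; M may be any probability space. *)
definition uniform_random_permutation ::
    "'w measure \<Rightarrow> nat \<Rightarrow> ('w \<Rightarrow> nat \<Rightarrow> nat) \<Rightarrow> bool" where
  "uniform_random_permutation M n \<sigma> \<longleftrightarrow>
     \<sigma> \<in> measurable M (count_space {p. p permutes {1..n}}) \<and>
     (\<forall>p. p permutes {1..n} \<longrightarrow> measure M {w \<in> space M. \<sigma> w = p} = 1 / fact n)"

definition permuted_sum :: "nat \<Rightarrow> (nat \<Rightarrow> nat \<Rightarrow> real) \<Rightarrow> (nat \<Rightarrow> nat) \<Rightarrow> real" where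
  "permuted_sum n a p = (\<Sum>i = 1..n. a i (p i))"

(* The concentration inequality must exclude the array that vanishes on {1..n} x {1..n}: there
   the deviation and the threshold are both 0, so the non-strict event has probability 1,
   whereas the exponential bound is below 1 for large x. *)

end

theory Submission
  imports Defs
begin

text \<open>
  The proof bounds the moment generating function of \<open>Z\<close> and applies Chernoff's inequality in both
  tails. Write \<open>\<mu>\<close> and \<open>v\<close> for the sums of the entries and of their squares, each divided by \<open>n\<close>,
  and let \<open>m\<close> be the largest entry. The claim is that
  \<open>E (exp (t (Z - \<mu>))) \<le> exp (5 t\<^sup>2 v)\<close> whenever \<open>\<bar>t\<bar> m \<le> 1/16\<close>.

  It is proved by induction on \<open>n\<close>, revealing the image \<open>j\<close> of a single row \<open>i\<close>. Given that
  image, what remains is a uniform bijection between the other rows and the other columns, so the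
  induction hypothesis applies to a smaller array, with a mean and a quadratic functional that depend
  on \<open>j\<close>. Up to an additive constant, the exponent is then \<open>y j = t (a i j - b j) - 5 t\<^sup>2 w j\<close>, where
  \<open>b j\<close> and \<open>w j\<close> average the entries and the squared entries of column \<open>j\<close> over the other rows, and
  the induction closes if the logarithm of the mean of \<open>exp (y j)\<close> exceeds the mean of \<open>y j\<close>
  by at most \<open>5 t\<^sup>2 r\<close>, where \<open>r\<close> is the mean square of row \<open>i\<close>. Since \<open>y j\<close> is bounded, this amounts
  to a bound on its second moment. The row \<open>a i\<close> contributes \<open>t\<^sup>2 r\<close> times a constant; the column
  averages contribute \<open>t\<^sup>2 (v - r) / (n - 1)\<close> times a constant. Revealing the row with the largest sum
  of squares makes \<open>(v - r) / (n - 1) \<le> r\<close>, so both contributions are paid for by \<open>r\<close> and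
  the constant 5 does not deteriorate along the induction. This is \<open>sum_exp_bijections_le\<close>.

  Choosing \<open>t\<close> as the smaller of \<open>1 / (16 m)\<close> and \<open>sqrt (x / v) / 16\<close> in Chernoff's bound gives
  the tail \<open>2 exp (- x / 16)\<close>, and \<open>2 \<le> 8 exp (1 / 16)\<close>.
\<close>

section \<open>Bijections between two finite sets\<close>

text \<open>
  Revealing the image of one point of a permutation leaves a bijection between two different sets.
  The values outside the domain are normalised to the identity so that the
  bijections from a set to itself are exactly its permutations.
\<close>

definition bijections :: "'a set \<Rightarrow> 'a set \<Rightarrow> ('a \<Rightarrow> 'a) set" where
  "bijections R C = {f. bij_betw f R C \<and> (\<forall>x. x \<notin> R \<longrightarrow> f x = x)}"

lemma bijections_self: "bijections R R = {p. p permutes R}"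
proof -
  have "bij_betw p R R \<and> (\<forall>x. x \<notin> R \<longrightarrow> p x = x) \<longleftrightarrow> p permutes R" for p
    by (metis bij_imp_permutes permutes_imp_bij permutes_not_in)
  then show ?thesis
    by (simp add: bijections_def)
qed

lemma bijections_empty: "bijections {} {} = {id}"
  by (simp add: bijections_def bij_betw_def fun_eq_iff set_eq_iff)

lemma finite_bijections:
  assumes "finite R" "finite C"
  shows "finite (bijections R C)"
proof -
  have "inj_on (\<lambda>f. restrict f R) (bijections R C)"
    by (auto simp: inj_on_def bijections_def fun_eq_iff restrict_def) metis
  moreover have "(\<lambda>f. restrict f R) ` bijections R C \<subseteq> R \<rightarrow>\<^sub>E C"
    by (auto simp: bijections_def bij_betw_apply)
  ultimately show ?thesis
    using assms by (meson finite_PiE finite_imageD finite_subset)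
qed

lemma sum_bijections_reveal:
  fixes F :: "('a \<Rightarrow> 'a) \<Rightarrow> 'b::comm_monoid_add"
  assumes "finite R" "finite C" "i \<in> R"
  shows "(\<Sum>f\<in>bijections R C. F f)
       = (\<Sum>j\<in>C. \<Sum>g\<in>bijections (R - {i}) (C - {j}). F (g(i := j)))"
proof -
  have remove: "bij_betw (f(i := i)) (R - {i}) (C - {f i})" if "bij_betw f R C" for f
  proof -
    have "bij_betw f (R - {i}) (C - {f i})"
      using that \<open>i \<in> R\<close> by (metis bij_betw_DiffI bij_betw_singletonI empty_subsetI
          insert_subset bij_betw_apply)
    then show ?thesis
      by (rule bij_betw_cong[THEN iffD1, rotated]) auto
  qed
  have add: "bij_betw (g(i := j)) R C" if "bij_betw g (R - {i}) (C - {j})" "j \<in> C" for g j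
  proof -
    have "bij_betw (g(i := j)) (R - {i}) (C - {j})"
      using that(1) by (rule bij_betw_cong[THEN iffD1, rotated]) auto
    then have "bij_betw (g(i := j)) ((R - {i}) \<union> {i}) ((C - {j}) \<union> {(g(i := j)) i})"
      by (intro notIn_Un_bij_betw) auto
    then show ?thesis
      using \<open>i \<in> R\<close> that(2) by (simp add: insert_absorb)
  qed
  have "(\<Sum>f\<in>bijections R C. F f)
      = (\<Sum>(j, g)\<in>Sigma C (\<lambda>j. bijections (R - {i}) (C - {j})). F (g(i := j)))"
  proof (rule sum.reindex_bij_witness[where i = "\<lambda>(j, g). g(i := j)" and j = "\<lambda>f. (f i, f(i := i))"])
    fix f assume "f \<in> bijections R C"
    then show "(f i, f(i := i)) \<in> Sigma C (\<lambda>j. bijections (R - {i}) (C - {j}))"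
      using remove \<open>i \<in> R\<close> by (auto simp: bijections_def bij_betw_apply)
  next
    fix q assume "q \<in> Sigma C (\<lambda>j. bijections (R - {i}) (C - {j}))"
    then show "(case q of (j, g) \<Rightarrow> g(i := j)) \<in> bijections R C"
      using add \<open>i \<in> R\<close> by (auto simp: bijections_def)
  qed (auto simp: bijections_def fun_eq_iff)
  also have "\<dots> = (\<Sum>j\<in>C. \<Sum>g\<in>bijections (R - {i}) (C - {j}). F (g(i := j)))"
    using assms by (subst sum.Sigma) (auto intro: finite_bijections)
  finally show ?thesis .
qed

lemma card_bijections:
  assumes "finite R" "finite C" "card R = n" "card C = n"
  shows "card (bijections R C) = fact n"
  using assms
proof (induction n arbitrary: R C)
  case 0
  then show ?case by (simp add: bijections_empty)
next
  case (Suc n)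
  obtain i where "i \<in> R" using Suc.prems by fastforce
  have "card (bijections R C) = (\<Sum>f\<in>bijections R C. 1)" by simp
  also have "\<dots> = (\<Sum>j\<in>C. \<Sum>g\<in>bijections (R - {i}) (C - {j}). 1)"
    using Suc.prems \<open>i \<in> R\<close> by (intro sum_bijections_reveal) auto
  also have "\<dots> = (\<Sum>j\<in>C. fact n)"
    using Suc.prems \<open>i \<in> R\<close> by (intro sum.cong) (auto intro!: Suc.IH)
  also have "\<dots> = fact (Suc n)" using Suc.prems by simp
  finally show ?case .
qed

lemma sum_permuted_sum:
  assumes "n \<ge> 1"
  shows "(\<Sum>p | p permutes {1..n}. permuted_sum n a p)
       = fact n * (1 / real n * (\<Sum>i = 1..n. \<Sum>j = 1..n. a i j))"
proof -
  have row: "(\<Sum>p | p permutes {1..n}. a i (p i)) = fact (n - 1) * (\<Sum>j = 1..n. a i j)"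
    if "i \<in> {1..n}" for i
  proof -
    have "(\<Sum>p\<in>bijections {1..n} {1..n}. a i (p i))
        = (\<Sum>j = 1..n. \<Sum>g\<in>bijections ({1..n} - {i}) ({1..n} - {j}). a i j)"
      using that by (subst sum_bijections_reveal[where i = i]) auto
    also have "\<dots> = (\<Sum>j = 1..n. fact (n - 1) * a i j)"
      using that by (intro sum.cong) (auto simp: card_bijections[where n = "n - 1"])
    finally show ?thesis
      by (simp add: bijections_self sum_distrib_left)
  qed
  have "(\<Sum>p | p permutes {1..n}. permuted_sum n a p)
      = (\<Sum>i = 1..n. \<Sum>p | p permutes {1..n}. a i (p i))"
    unfolding permuted_sum_def by (rule sum.swap)
  also have "\<dots> = fact (n - 1) * (\<Sum>i = 1..n. \<Sum>j = 1..n. a i j)"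
    by (simp only: sum_distrib_left[of "fact (n - 1)"] sum.cong[OF refl row])
  also have "\<dots> = fact n * (1 / real n * (\<Sum>i = 1..n. \<Sum>j = 1..n. a i j))"
    using assms by (simp add: fact_reduce)
  finally show ?thesis .
qed

section \<open>The moment generating function\<close>

lemma exp_le_quadratic:
  fixes y :: real
  assumes "\<bar>y\<bar> \<le> 1"
  shows "exp y \<le> 1 + y + y\<^sup>2"
proof (cases "y \<ge> 0")
  case True
  then show ?thesis using assms exp_bound by simp
next
  case False
  define z where "z = - y"
  have z: "0 \<le> z" "1 + z + z\<^sup>2 / 2 \<le> exp z"
    using False exp_lower_Taylor_quadratic[of "- y"] by (auto simp: z_def)
  \<comment> \<open>The factor \<open>1 - z + z\<^sup>2\<close> bounds \<open>exp (- z)\<close> because its product with the Taylor polynomial of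
      \<open>exp z\<close> is at least 1.\<close>
  have "0 \<le> 1 - z + z\<^sup>2"
    using assms False by (simp add: z_def)
  have "1 \<le> 1 + (z ^ 2 + z ^ 3 + z ^ 4) / 2"
    using z(1) by simp
  also have "\<dots> = (1 - z + z\<^sup>2) * (1 + z + z\<^sup>2 / 2)"
    by (simp add: field_simps power2_eq_square power3_eq_cube power4_eq_xxxx)
  also have "\<dots> \<le> (1 - z + z\<^sup>2) * exp z"
    using z(2) \<open>0 \<le> 1 - z + z\<^sup>2\<close> by (rule mult_left_mono)
  finally have "1 \<le> (1 - z + z\<^sup>2) * exp z" .
  then show ?thesis
    by (simp add: z_def exp_minus field_simps)
qed

text \<open>
  The inequality \<open>1 + z \<le> exp z\<close> is applied to the averages and not term by term. The mean of \<open>y\<close>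
  thus stays in the exponent with coefficient 1, and only the second moment is lost.
\<close>

lemma sum_exp_le:
  fixes y :: "'a \<Rightarrow> real"
  assumes "finite C" "C \<noteq> {}" and "\<And>j. j \<in> C \<Longrightarrow> \<bar>y j\<bar> \<le> 1"
  shows "(\<Sum>j\<in>C. exp (y j))
       \<le> real (card C) * exp ((\<Sum>j\<in>C. y j) / real (card C) + (\<Sum>j\<in>C. (y j)\<^sup>2) / real (card C))"
proof -
  let ?N = "real (card C)"
  have N: "?N > 0" using assms by (simp add: card_gt_0_iff)
  have "(\<Sum>j\<in>C. exp (y j)) \<le> (\<Sum>j\<in>C. 1 + y j + (y j)\<^sup>2)"
    using assms by (intro sum_mono exp_le_quadratic) auto
  also have "\<dots> = ?N * (1 + ((\<Sum>j\<in>C. y j) / ?N + (\<Sum>j\<in>C. (y j)\<^sup>2) / ?N))"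
    using N by (simp add: sum.distrib field_simps)
  also have "\<dots> \<le> ?N * exp ((\<Sum>j\<in>C. y j) / ?N + (\<Sum>j\<in>C. (y j)\<^sup>2) / ?N)"
    using N by (intro mult_left_mono exp_ge_add_one_self) auto
  finally show ?thesis .
qed

lemma power2_diff_le:
  fixes p q :: real
  shows "(p - q)\<^sup>2 \<le> 2 * p\<^sup>2 + 2 * q\<^sup>2"
  using zero_le_power2[of "p + q"] by (simp add: power2_eq_square algebra_simps)

lemma power2_mean_le:
  fixes f :: "'a \<Rightarrow> real"
  assumes "card S = n"
  shows "((\<Sum>k\<in>S. f k) / real n)\<^sup>2 \<le> (\<Sum>k\<in>S. (f k)\<^sup>2) / real n"
proof (cases "n = 0")
  case False
  have "(\<Sum>k\<in>S. 1 * f k)\<^sup>2 \<le> (\<Sum>k\<in>S. 1\<^sup>2) * (\<Sum>k\<in>S. (f k)\<^sup>2)"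
    by (rule Cauchy_Schwarz_ineq_sum)
  then show ?thesis
    using False assms by (simp add: power_divide field_simps power2_eq_square)
qed simp

text \<open>
  The exponent is centred at the mean of the sum, up to the quadratic functional that plays the role
  of its variance. The sign of \<open>t\<close> is arbitrary, which covers both tails.

  The constant 5 is the total of three second-moment contributions, each in units of \<open>t\<^sup>2\<close> times
  the sum of squares \<open>u i\<close> of the revealed row: 2 from the row itself, 2 from the column averages \<open>b j\<close>,
  whose squares are at most \<open>w j\<close> by Cauchy-Schwarz, and 1 from the fluctuation \<open>5 t\<^sup>2 w j\<close> of the
  quadratic functional. The last one is where \<open>\<bar>t\<bar> m \<le> 1/16\<close> matters: it makes the
  term \<open>2 (5 t\<^sup>2 w j)\<^sup>2\<close>, which is of order \<open>t\<^sup>4\<close>, at most \<open>t\<^sup>2 w j\<close>.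
\<close>

lemma sum_exp_bijections_le:
  fixes a :: "'a \<Rightarrow> 'a \<Rightarrow> real"
  assumes "finite R" "finite C" "card R = n" "card C = n"
    and "\<And>i j. i \<in> R \<Longrightarrow> j \<in> C \<Longrightarrow> 0 \<le> a i j"
    and "\<And>i j. i \<in> R \<Longrightarrow> j \<in> C \<Longrightarrow> a i j \<le> m"
    and "m \<ge> 0" and t: "\<bar>t\<bar> * m \<le> 1 / 16"
  shows "(\<Sum>f\<in>bijections R C. exp (t * (\<Sum>i\<in>R. a i (f i))))
       \<le> fact n * exp (t * ((\<Sum>i\<in>R. \<Sum>j\<in>C. a i j) / real n)
                       + 5 * t\<^sup>2 * ((\<Sum>i\<in>R. \<Sum>j\<in>C. (a i j)\<^sup>2) / real n))"
  using assms(1-6)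
proof (induction n arbitrary: R C)
  case 0
  then show ?case by (simp add: bijections_empty)
next
  case (Suc n)
  define N where "N = real (Suc n)"
  have N: "N > 0" "N = real n + 1" "N = real (card R)" "N = real (card C)"
    using Suc.prems by (auto simp: N_def)
  have "R \<noteq> {}" "C \<noteq> {}" using Suc.prems by auto
  define u where "u k = (\<Sum>l\<in>C. (a k l)\<^sup>2)" for k
  obtain i where i: "i \<in> R" and i_max: "\<And>k. k \<in> R \<Longrightarrow> u k \<le> u i"
  proof -
    have "Max (u ` R) \<in> u ` R" using Suc.prems \<open>R \<noteq> {}\<close> by (intro Max_in) auto
    then obtain i where "i \<in> R" "u i = Max (u ` R)" by auto
    then show thesis using that Suc.prems by (metis Max_ge finite_imageI imageI)
  qed
  define S where "S = R - {i}"
  have S: "finite S" "card S = n" "S \<subseteq> R" "i \<notin> S"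
    using Suc.prems i by (auto simp: S_def)
  have R: "(\<Sum>k\<in>R. h k) = h i + (\<Sum>k\<in>S. h k)" for h :: "'a \<Rightarrow> real"
    unfolding S_def using Suc.prems i by (intro sum.remove) auto
  define T where "T = (\<Sum>k\<in>S. \<Sum>l\<in>C. a k l)"
  define Q where "Q = (\<Sum>k\<in>S. u k)"
  define b where "b j = (\<Sum>k\<in>S. a k j) / real n" for j
  define w where "w j = (\<Sum>k\<in>S. (a k j)\<^sup>2) / real n" for j
  define y where "y j = t * (a i j - b j) - 5 * t\<^sup>2 * w j" for j
  have sum_b: "(\<Sum>j\<in>C. b j) = T / real n"
    unfolding b_def T_def by (subst sum.swap) (simp add: sum_divide_distrib)
  have sum_w: "(\<Sum>j\<in>C. w j) = Q / real n"
    unfolding w_def Q_def u_def by (subst sum.swap) (simp add: sum_divide_distrib)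
  have rest: "(\<Sum>g\<in>bijections S (C - {j}). exp (t * (\<Sum>k\<in>R. a k ((g(i := j)) k))))
      \<le> fact n * exp (t * (T / real n) + 5 * t\<^sup>2 * (Q / real n)) * exp (y j)"
    if j: "j \<in> C" for j
  proof -
    have "(\<Sum>k\<in>R. a k ((g(i := j)) k)) = a i j + (\<Sum>k\<in>S. a k (g k))" for g
    proof -
      have "(\<Sum>k\<in>S. a k ((g(i := j)) k)) = (\<Sum>k\<in>S. a k (g k))"
        using S by (intro sum.cong) auto
      then show ?thesis by (simp add: R)
    qed
    then have "(\<Sum>g\<in>bijections S (C - {j}). exp (t * (\<Sum>k\<in>R. a k ((g(i := j)) k))))
        = exp (t * a i j) * (\<Sum>g\<in>bijections S (C - {j}). exp (t * (\<Sum>k\<in>S. a k (g k))))"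
      by (simp add: distrib_left exp_add sum_distrib_left)
    also have "\<dots> \<le> exp (t * a i j) * (fact n *
        exp (t * ((\<Sum>k\<in>S. \<Sum>l\<in>C - {j}. a k l) / real n)
             + 5 * t\<^sup>2 * ((\<Sum>k\<in>S. \<Sum>l\<in>C - {j}. (a k l)\<^sup>2) / real n)))"
      using S j Suc.prems by (intro mult_left_mono Suc.IH) auto
    also have "(\<Sum>k\<in>S. \<Sum>l\<in>C - {j}. a k l) / real n = T / real n - b j"
      using j Suc.prems unfolding T_def b_def
      by (simp add: sum_diff1 sum_subtractf diff_divide_distrib)
    also have "(\<Sum>k\<in>S. \<Sum>l\<in>C - {j}. (a k l)\<^sup>2) / real n = Q / real n - w j"
      using j Suc.prems unfolding Q_def w_def u_def
      by (simp add: sum_diff1 sum_subtractf diff_divide_distrib)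
    also have "exp (t * a i j) * (fact n * exp (t * (T / real n - b j) + 5 * t\<^sup>2 * (Q / real n - w j)))
        = fact n * exp (t * a i j + (t * (T / real n - b j) + 5 * t\<^sup>2 * (Q / real n - w j)))"
      by (simp only: exp_add mult_ac)
    also have "t * a i j + (t * (T / real n - b j) + 5 * t\<^sup>2 * (Q / real n - w j))
        = (t * (T / real n) + 5 * t\<^sup>2 * (Q / real n)) + y j"
      by (simp add: y_def algebra_simps)
    finally show ?thesis
      by (simp only: exp_add mult_ac)
  qed
  have b: "0 \<le> b j" "b j \<le> m" and w: "0 \<le> w j" "w j \<le> m\<^sup>2" if j: "j \<in> C" for j
  proof -
    have pos: "0 \<le> a k j" "a k j \<le> m" if "k \<in> S" for k
      using that S j Suc.prems(5,6) by auto
    show "0 \<le> b j" "0 \<le> w j"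
      using pos by (auto simp: b_def w_def intro!: divide_nonneg_nonneg sum_nonneg)
    have "(\<Sum>k\<in>S. a k j) \<le> real n * m" "(\<Sum>k\<in>S. (a k j)\<^sup>2) \<le> real n * m\<^sup>2"
      using sum_bounded_above[of S "\<lambda>k. a k j" m] sum_bounded_above[of S "\<lambda>k. (a k j)\<^sup>2" "m\<^sup>2"]
        pos S by (auto simp: power_mono)
    then show "b j \<le> m" "w j \<le> m\<^sup>2"
      using \<open>m \<ge> 0\<close> by (cases "n = 0"; simp add: b_def w_def field_simps)+
  qed
  have tm: "t\<^sup>2 * m\<^sup>2 \<le> 1 / 256"
  proof -
    have "(\<bar>t\<bar> * m)\<^sup>2 \<le> (1 / 16)\<^sup>2" using t \<open>m \<ge> 0\<close> by (intro power_mono) auto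
    then show ?thesis by (simp add: power_mult_distrib power_divide)
  qed
  have y_bound: "\<bar>y j\<bar> \<le> 1" if j: "j \<in> C" for j
  proof -
    have "\<bar>a i j - b j\<bar> \<le> m"
      using b[OF j] Suc.prems(5,6)[OF i j] by auto
    then have "\<bar>t * (a i j - b j)\<bar> \<le> \<bar>t\<bar> * m"
      by (simp add: abs_mult mult_left_mono)
    moreover have "t\<^sup>2 * w j \<le> t\<^sup>2 * m\<^sup>2" "0 \<le> t\<^sup>2 * w j"
      using w[OF j] by (auto intro: mult_left_mono)
    ultimately show ?thesis
      using t tm unfolding y_def by linarith
  qed
  have y_square: "(y j)\<^sup>2 \<le> 2 * t\<^sup>2 * (a i j)\<^sup>2 + 3 * t\<^sup>2 * w j" if j: "j \<in> C" for j
  proof -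
    have "(y j)\<^sup>2 \<le> 2 * (t * (a i j - b j))\<^sup>2 + 2 * (5 * t\<^sup>2 * w j)\<^sup>2"
      unfolding y_def by (rule power2_diff_le)
    also have "2 * (t * (a i j - b j))\<^sup>2 \<le> 2 * t\<^sup>2 * ((a i j)\<^sup>2 + w j)"
    proof -
      \<comment> \<open>Nonnegativity of the entries makes the mixed term favourable.\<close>
      have "(a i j - b j)\<^sup>2 \<le> (a i j)\<^sup>2 + (b j)\<^sup>2"
        using b[OF j] Suc.prems(5)[OF i j] by (simp add: power2_diff)
      also have "(b j)\<^sup>2 \<le> w j"
        unfolding b_def w_def by (rule power2_mean_le) (rule S)
      finally show ?thesis
        by (simp add: power_mult_distrib mult_left_mono)
    qed
    also have "2 * (5 * t\<^sup>2 * w j)\<^sup>2 \<le> t\<^sup>2 * w j"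
    proof -
      have "2 * (5 * t\<^sup>2 * w j)\<^sup>2 = 50 * (t\<^sup>2 * w j) * (t\<^sup>2 * w j)"
        by (simp add: power2_eq_square)
      also have "\<dots> \<le> 1 * (t\<^sup>2 * w j)"
      proof (rule mult_right_mono)
        have "t\<^sup>2 * w j \<le> t\<^sup>2 * m\<^sup>2" using w[OF j] by (auto intro: mult_left_mono)
        then show "50 * (t\<^sup>2 * w j) \<le> 1" using tm by linarith
      qed (use w[OF j] in auto)
      finally show ?thesis by simp
    qed
    finally show ?thesis by (simp add: algebra_simps)
  qed
  \<comment> \<open>This is where the choice of the revealed row enters.\<close>
  have sum_w_le: "(\<Sum>j\<in>C. w j) \<le> u i"
  proof -
    have "Q \<le> real n * u i"
      unfolding Q_def using sum_bounded_above[of S u "u i"] i_max S by auto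
    moreover have "u i \<ge> 0" by (auto simp: u_def intro: sum_nonneg)
    ultimately show ?thesis
      unfolding sum_w by (cases "n = 0") (auto simp: field_simps)
  qed
  have sum_y_square: "(\<Sum>j\<in>C. (y j)\<^sup>2) \<le> 5 * t\<^sup>2 * u i"
  proof -
    have "(\<Sum>j\<in>C. (y j)\<^sup>2) \<le> (\<Sum>j\<in>C. 2 * t\<^sup>2 * (a i j)\<^sup>2 + 3 * t\<^sup>2 * w j)"
      by (intro sum_mono y_square)
    also have "\<dots> = 2 * t\<^sup>2 * u i + 3 * t\<^sup>2 * (\<Sum>j\<in>C. w j)"
      by (simp add: sum.distrib sum_distrib_left u_def)
    also have "\<dots> \<le> 2 * t\<^sup>2 * u i + 3 * t\<^sup>2 * u i"
      using sum_w_le by (intro add_left_mono mult_left_mono) auto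
    finally show ?thesis by (simp add: algebra_simps)
  qed
  have sum_y: "(\<Sum>j\<in>C. y j) = t * ((\<Sum>j\<in>C. a i j) - T / real n) - 5 * t\<^sup>2 * (Q / real n)"
    unfolding y_def by (simp only: sum_subtractf sum_distrib_left[symmetric] sum_b sum_w)
  \<comment> \<open>For \<open>n = 0\<close> the set \<open>S\<close> is empty, so \<open>T = Q = 0\<close>; the case \<open>n = 0\<close> of the induction
      therefore passes through the same identities, with division by zero yielding 0.\<close>
  have split: "s / real n - s / real n / N = s / N" if "s = 0 \<or> n \<noteq> 0" for s
  proof (cases "n = 0")
    case False
    then have "s / real n - s / real n / N = s / N * ((N - 1) / real n)"
      using N(1) by (simp add: field_simps)
    then show ?thesis using False N(2) by simp
  qed (use that in simp)
  have S0: "S = {}" if "n = 0"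
    using that S(1,2) by simp
  have T0: "T = 0 \<or> n \<noteq> 0"
    unfolding T_def by (cases "n = 0") (simp_all only: S0 sum.empty simp_thms)
  have Q0: "Q = 0 \<or> n \<noteq> 0"
    unfolding Q_def by (cases "n = 0") (simp_all only: S0 sum.empty simp_thms)
  note split_TQ = split[OF T0] split[OF Q0]
  have "(\<Sum>f\<in>bijections R C. exp (t * (\<Sum>k\<in>R. a k (f k))))
      = (\<Sum>j\<in>C. \<Sum>g\<in>bijections S (C - {j}). exp (t * (\<Sum>k\<in>R. a k ((g(i := j)) k))))"
    unfolding S_def using Suc.prems i
    by (intro sum_bijections_reveal) auto
  also have "\<dots> \<le> (\<Sum>j\<in>C. fact n * exp (t * (T / real n) + 5 * t\<^sup>2 * (Q / real n)) * exp (y j))"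
    by (intro sum_mono rest)
  also have "\<dots> = fact n * exp (t * (T / real n) + 5 * t\<^sup>2 * (Q / real n)) * (\<Sum>j\<in>C. exp (y j))"
    by (simp add: sum_distrib_left)
  also have "\<dots> \<le> fact n * exp (t * (T / real n) + 5 * t\<^sup>2 * (Q / real n))
      * (N * exp ((\<Sum>j\<in>C. y j) / N + (\<Sum>j\<in>C. (y j)\<^sup>2) / N))"
  proof (rule mult_left_mono)
    show "(\<Sum>j\<in>C. exp (y j)) \<le> N * exp ((\<Sum>j\<in>C. y j) / N + (\<Sum>j\<in>C. (y j)\<^sup>2) / N)"
      unfolding N(4) using \<open>finite C\<close> \<open>C \<noteq> {}\<close> y_bound by (rule sum_exp_le)
  qed simp
  also have "\<dots> = fact (Suc n) * exp (t * (T / real n) + 5 * t\<^sup>2 * (Q / real n)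
      + (\<Sum>j\<in>C. y j) / N + (\<Sum>j\<in>C. (y j)\<^sup>2) / N)"
    by (simp only: exp_add N_def fact_Suc of_nat_mult mult_ac)
  also have "\<dots> \<le> fact (Suc n) * exp (t * (T / real n) + 5 * t\<^sup>2 * (Q / real n)
      + (\<Sum>j\<in>C. y j) / N + 5 * t\<^sup>2 * u i / N)"
    using divide_right_mono[OF sum_y_square, of N] N(1)
    by (intro mult_left_mono exp_le_cancel_iff[THEN iffD2] add_left_mono) simp_all
  also have "t * (T / real n) + 5 * t\<^sup>2 * (Q / real n) + (\<Sum>j\<in>C. y j) / N + 5 * t\<^sup>2 * u i / N
      = t * ((T / real n - T / real n / N) + (\<Sum>j\<in>C. a i j) / N)
        + 5 * t\<^sup>2 * ((Q / real n - Q / real n / N) + u i / N)"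
    unfolding sum_y by (simp add: diff_divide_distrib add_divide_distrib algebra_simps)
  also have "\<dots> = t * ((\<Sum>k\<in>R. \<Sum>j\<in>C. a k j) / N) + 5 * t\<^sup>2 * ((\<Sum>k\<in>R. u k) / N)"
  proof -
    have "(\<Sum>k\<in>R. \<Sum>j\<in>C. a k j) = T + (\<Sum>j\<in>C. a i j)" "(\<Sum>k\<in>R. u k) = Q + u i"
      unfolding R T_def Q_def by (rule add.commute)+
    then show ?thesis
      unfolding split_TQ by (simp only: add_divide_distrib)
  qed
  finally show ?case
    by (simp add: N_def u_def)
qed

section \<open>Chernoff's bound\<close>

lemma sum_abs_deviation_le:
  fixes F :: "'p \<Rightarrow> real"
  assumes "finite P" "t \<ge> 0"
    and "(\<Sum>p\<in>P. exp (t * F p)) \<le> K * exp (t * \<mu> + c)"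
    and "(\<Sum>p\<in>P. exp (- t * F p)) \<le> K * exp (- t * \<mu> + c)"
  shows "(\<Sum>p\<in>P. of_bool (\<bar>F p - \<mu>\<bar> \<ge> s)) \<le> 2 * K * exp (c - t * s)"
proof -
  have "(\<Sum>p\<in>P. of_bool (\<bar>F p - \<mu>\<bar> \<ge> s))
      \<le> (\<Sum>p\<in>P. exp (- t * s - t * \<mu>) * exp (t * F p) + exp (- t * s + t * \<mu>) * exp (- t * F p))"
  proof (rule sum_mono)
    fix p
    show "of_bool (\<bar>F p - \<mu>\<bar> \<ge> s)
      \<le> exp (- t * s - t * \<mu>) * exp (t * F p) + exp (- t * s + t * \<mu>) * exp (- t * F p)"
    proof (cases "\<bar>F p - \<mu>\<bar> \<ge> s")
      case True
      then have "t * s \<le> t * \<bar>F p - \<mu>\<bar>" using \<open>t \<ge> 0\<close> by (intro mult_left_mono)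
      then have "0 \<le> - t * s - t * \<mu> + t * F p \<or> 0 \<le> - t * s + t * \<mu> - t * F p"
        by (cases "F p \<ge> \<mu>") (simp_all add: algebra_simps)
      then have "1 \<le> exp (- t * s - t * \<mu> + t * F p) \<or> 1 \<le> exp (- t * s + t * \<mu> - t * F p)"
        by simp
      then have "1 \<le> exp (- t * s - t * \<mu> + t * F p) + exp (- t * s + t * \<mu> - t * F p)"
        by (blast intro: add_increasing add_increasing2 exp_ge_zero)
      then show ?thesis using True by (simp flip: exp_add)
    qed simp
  qed
  also have "\<dots> = exp (- t * s - t * \<mu>) * (\<Sum>p\<in>P. exp (t * F p))
      + exp (- t * s + t * \<mu>) * (\<Sum>p\<in>P. exp (- t * F p))"
    by (simp add: sum.distrib sum_distrib_left)
  also have "\<dots> \<le> exp (- t * s - t * \<mu>) * (K * exp (t * \<mu> + c))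
      + exp (- t * s + t * \<mu>) * (K * exp (- t * \<mu> + c))"
    using assms by (intro add_mono mult_left_mono) auto
  also have "\<dots> = K * exp ((- t * s - t * \<mu>) + (t * \<mu> + c))
      + K * exp ((- t * s + t * \<mu>) + (- t * \<mu> + c))"
    by (simp only: exp_add mult_ac)
  also have "\<dots> = 2 * K * exp (c - t * s)"
    by simp
  finally show ?thesis .
qed

text \<open>
  Without the constraint \<open>t m \<le> 1/16\<close> the value \<open>t = sqrt (x / v) / 16\<close> suffices, and the
  term \<open>2 sqrt (v x)\<close> of the deviation alone gives the bound. When that value is too large,
  \<open>t = 1 / (16 m)\<close> gains exactly \<open>x / 16\<close> from the term \<open>m x\<close>, and \<open>sqrt v < m sqrt x\<close> makes the
  quadratic term smaller than the gain from \<open>2 sqrt (v x)\<close>.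
\<close>

lemma chernoff_exponent:
  fixes v m x :: real
  assumes "v > 0" "m > 0" "x > 0"
  obtains t where "t \<ge> 0" "t * m \<le> 1 / 16"
    "5 * t\<^sup>2 * v - t * (2 * sqrt (v * x) + m * x) \<le> - x / 16"
proof (cases "m * sqrt x \<le> sqrt v")
  case True
  define s y where "s = sqrt v" and "y = sqrt x"
  have sy: "s > 0" "y > 0" "v = s\<^sup>2" "x = y\<^sup>2" "sqrt (v * x) = s * y" "m * y \<le> s"
    using assms True by (auto simp: s_def y_def real_sqrt_mult)
  let ?t = "y / (16 * s)"
  have "5 * ?t\<^sup>2 * v = 5 / 256 * y\<^sup>2" "?t * (2 * sqrt (v * x) + m * x) = y\<^sup>2 / 8 + ?t * (m * x)"
    unfolding sy(5) unfolding sy(3) using sy(1) by (auto simp: field_simps power2_eq_square)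
  moreover have "?t * (m * x) \<ge> 0" "y\<^sup>2 \<ge> 0" using sy assms by auto
  ultimately have "5 * ?t\<^sup>2 * v - ?t * (2 * sqrt (v * x) + m * x) \<le> - x / 16"
    unfolding sy(4) by linarith
  moreover have "?t \<ge> 0" "?t * m \<le> 1 / 16" using sy by (auto simp: field_simps)
  ultimately show thesis using that by blast
next
  case False
  define s y where "s = sqrt v" and "y = sqrt x"
  have sy: "s > 0" "y > 0" "v = s\<^sup>2" "x = y\<^sup>2" "sqrt (v * x) = s * y" "s \<le> m * y"
    using assms False by (auto simp: s_def y_def real_sqrt_mult)
  let ?t = "1 / (16 * m)"
  have "s * s \<le> m * y * s" using sy by (intro mult_right_mono) auto
  then have "5 * ?t\<^sup>2 * v \<le> 5 / 256 * (s * y / m)"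
    unfolding sy(3) using \<open>m > 0\<close> by (simp add: field_simps power2_eq_square)
  moreover have "?t * (2 * sqrt (v * x) + m * x) = 1 / 8 * (s * y / m) + x / 16"
    unfolding sy(5) using \<open>m > 0\<close> by (simp add: field_simps)
  moreover have "s * y / m \<ge> 0" using sy assms by simp
  ultimately have "5 * ?t\<^sup>2 * v - ?t * (2 * sqrt (v * x) + m * x) \<le> - x / 16"
    by linarith
  moreover have "?t \<ge> 0" "?t * m \<le> 1 / 16" using assms by auto
  ultimately show thesis using that by blast
qed

section \<open>Uniform random permutations\<close>

lemma (in prob_space) expectation_uniform_random_permutation:
  fixes F :: "(nat \<Rightarrow> nat) \<Rightarrow> real"
  assumes "uniform_random_permutation M n \<sigma>"
  shows "expectation (\<lambda>w. F (\<sigma> w)) = (\<Sum>p | p permutes {1..n}. F p) / fact n"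
proof -
  let ?P = "{p. p permutes {1..n}}"
  define A where "A p = {w \<in> space M. \<sigma> w = p}" for p
  have \<sigma>: "\<sigma> \<in> measurable M (count_space ?P)"
    and unif: "\<And>p. p permutes {1..n} \<Longrightarrow> prob (A p) = 1 / fact n"
    using assms by (auto simp: uniform_random_permutation_def A_def)
  have fin: "finite ?P" by (rule finite_permutations) simp
  have A: "A p \<in> events" if "p \<in> ?P" for p
  proof -
    have "A p = \<sigma> -` {p} \<inter> space M" by (auto simp: A_def)
    then show ?thesis using measurable_sets[OF \<sigma>, of "{p}"] that by simp
  qed
  have "F (\<sigma> w) = (\<Sum>p\<in>?P. F p * indicator (A p) w)" if w: "w \<in> space M" for w
  proof -
    have "\<sigma> w \<in> ?P" using measurable_space[OF \<sigma> w] by simp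
    moreover have "(\<Sum>p\<in>?P. F p * indicator (A p) w) = (\<Sum>p\<in>?P. if p = \<sigma> w then F p else 0)"
      using w by (intro sum.cong) (auto simp: A_def indicator_def)
    ultimately show ?thesis using fin by (simp add: sum.delta)
  qed
  then have "expectation (\<lambda>w. F (\<sigma> w)) = expectation (\<lambda>w. \<Sum>p\<in>?P. F p * indicator (A p) w)"
    by (intro Bochner_Integration.integral_cong) auto
  also have "\<dots> = (\<Sum>p\<in>?P. F p * prob (A p))"
    using A by (subst Bochner_Integration.integral_sum) (auto simp: emeasure_eq_measure)
  also have "\<dots> = (\<Sum>p\<in>?P. F p) / fact n"
    using unif by (simp add: sum_divide_distrib)
  finally show ?thesis .
qed

lemma (in prob_space) prob_uniform_random_permutation:
  assumes "uniform_random_permutation M n \<sigma>"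
  shows "prob {w \<in> space M. Q (\<sigma> w)} = (\<Sum>p | p permutes {1..n}. of_bool (Q p)) / fact n"
proof -
  have \<sigma>: "\<sigma> \<in> measurable M (count_space {p. p permutes {1..n}})"
    using assms by (simp add: uniform_random_permutation_def)
  have "prob {w \<in> space M. Q (\<sigma> w)} = expectation (indicator {w \<in> space M. Q (\<sigma> w)})"
    by (simp add: Int_def conj_ac)
  also have "\<dots> = expectation (\<lambda>w. of_bool (Q (\<sigma> w)))"
    by (intro Bochner_Integration.integral_cong) (auto simp: indicator_def)
  also have "\<dots> = (\<Sum>p | p permutes {1..n}. of_bool (Q p)) / fact n"
    by (rule expectation_uniform_random_permutation[OF assms])
  finally show ?thesis .
qed

theorem proposition2p2:
  fixes M :: "'w measure" and n :: nat and a :: "nat \<Rightarrow> nat \<Rightarrow> real"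
    and \<sigma> :: "'w \<Rightarrow> nat \<Rightarrow> nat" and Z :: "'w \<Rightarrow> real" and x :: real
  assumes "prob_space M"
    and "n \<ge> 1"
    and "\<And>i j. i \<in> {1..n} \<Longrightarrow> j \<in> {1..n} \<Longrightarrow> a i j \<ge> 0"
    and "\<exists>i\<in>{1..n}. \<exists>j\<in>{1..n}. a i j \<noteq> 0"
    and "uniform_random_permutation M n \<sigma>"
    and "\<And>w. Z w = permuted_sum n a (\<sigma> w)"
    and "x > 0"
  shows "measure M {w \<in> space M.
           \<bar>Z w - integral\<^sup>L M Z\<bar> \<ge>
             2 * sqrt ((1 / real n * (\<Sum>i = 1..n. \<Sum>j = 1..n. (a i j)\<^sup>2)) * x)
               + Max {a i j | i j. i \<in> {1..n} \<and> j \<in> {1..n}} * x}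
         \<le> 8 * exp (1 / 16) * exp (- x / 16)"
proof -
  interpret prob_space M by fact
  have Z: "Z = (\<lambda>w. permuted_sum n a (\<sigma> w))"
    using assms(6) by (rule ext)
  define m where "m = Max {a i j | i j. i \<in> {1..n} \<and> j \<in> {1..n}}"
  define v where "v = 1 / real n * (\<Sum>i = 1..n. \<Sum>j = 1..n. (a i j)\<^sup>2)"
  define \<mu> where "\<mu> = 1 / real n * (\<Sum>i = 1..n. \<Sum>j = 1..n. a i j)"
  define s where "s = 2 * sqrt (v * x) + m * x"
  let ?P = "{p. p permutes {1..n}}"
  have a_le: "a i j \<le> m" if "i \<in> {1..n}" "j \<in> {1..n}" for i j
    unfolding m_def
  proof (rule Max_ge)
    have "{a i j | i j. i \<in> {1..n} \<and> j \<in> {1..n}} = (\<lambda>(i, j). a i j) ` ({1..n} \<times> {1..n})"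
      by (auto simp: image_iff) blast
    then show "finite {a i j | i j. i \<in> {1..n} \<and> j \<in> {1..n}}" by simp
  qed (use that in auto)
  obtain i0 j0 where ij0: "i0 \<in> {1..n}" "j0 \<in> {1..n}" "a i0 j0 > 0"
    using assms(3,4) by force
  then have "m > 0" using a_le by force
  have "(a i0 j0)\<^sup>2 \<le> (\<Sum>j = 1..n. (a i0 j)\<^sup>2)"
    using ij0 by (intro member_le_sum) auto
  also have "\<dots> \<le> (\<Sum>i = 1..n. \<Sum>j = 1..n. (a i j)\<^sup>2)"
    using ij0 by (intro member_le_sum[of i0 "{1..n}" "\<lambda>i. \<Sum>j = 1..n. (a i j)\<^sup>2"] sum_nonneg) auto
  finally have "0 < (\<Sum>i = 1..n. \<Sum>j = 1..n. (a i j)\<^sup>2)"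
    using zero_less_power[OF ij0(3), of 2] by linarith
  then have "v > 0"
    using \<open>n \<ge> 1\<close> by (simp add: v_def)
  obtain t where t: "t \<ge> 0" "t * m \<le> 1 / 16" "5 * t\<^sup>2 * v - t * s \<le> - x / 16"
    unfolding s_def using chernoff_exponent[OF \<open>v > 0\<close> \<open>m > 0\<close> \<open>x > 0\<close>] .
  have mgf: "(\<Sum>p\<in>?P. exp (\<tau> * permuted_sum n a p)) \<le> fact n * exp (\<tau> * \<mu> + 5 * t\<^sup>2 * v)"
    if "\<bar>\<tau>\<bar> = t" for \<tau>
  proof -
    have "\<tau>\<^sup>2 = t\<^sup>2" using that by (metis power2_abs)
    moreover have "(\<Sum>p\<in>bijections {1..n} {1..n}. exp (\<tau> * (\<Sum>i = 1..n. a i (p i))))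
        \<le> fact n * exp (\<tau> * ((\<Sum>i = 1..n. \<Sum>j = 1..n. a i j) / real n)
                       + 5 * \<tau>\<^sup>2 * ((\<Sum>i = 1..n. \<Sum>j = 1..n. (a i j)\<^sup>2) / real n))"
      by (rule sum_exp_bijections_le[of _ _ _ _ m])
         (use that assms(3) a_le \<open>m > 0\<close> t(2) in auto)
    ultimately show ?thesis
      by (simp add: bijections_self permuted_sum_def \<mu>_def v_def)
  qed
  have "(\<Sum>p\<in>?P. of_bool (\<bar>permuted_sum n a p - \<mu>\<bar> \<ge> s)) \<le> 2 * fact n * exp (5 * t\<^sup>2 * v - t * s)"
    using mgf[of t] mgf[of "- t"] \<open>t \<ge> 0\<close>
    by (intro sum_abs_deviation_le) (simp_all add: finite_permutations)
  also have "\<dots> \<le> fact n * (8 * exp (1 / 16) * exp (- x / 16))"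
  proof -
    have "2 * exp (5 * t\<^sup>2 * v - t * s) \<le> 2 * exp (- x / 16)" using t(3) by simp
    also have "\<dots> \<le> 8 * exp (1 / 16) * exp (- x / 16)"
      by (intro mult_right_mono) (use one_le_exp_iff[of "1 / 16 :: real"] in linarith, simp)
    finally show ?thesis by (simp add: mult.left_commute)
  qed
  finally have "(\<Sum>p\<in>?P. of_bool (\<bar>permuted_sum n a p - \<mu>\<bar> \<ge> s)) / fact n
      \<le> 8 * exp (1 / 16) * exp (- x / 16)"
    by (subst pos_divide_le_eq) (simp_all add: mult_ac)
  moreover have "expectation Z = \<mu>"
    using sum_permuted_sum[OF \<open>n \<ge> 1\<close>, of a]
    by (simp add: Z expectation_uniform_random_permutation[OF assms(5)] \<mu>_def)
  ultimately show ?thesis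
    using prob_uniform_random_permutation[OF assms(5), of "\<lambda>p. \<bar>permuted_sum n a p - \<mu>\<bar> \<ge> s"]
    unfolding s_def m_def v_def Z by simp
qed

end
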